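(* Let $\mathbb X$ and $\mathbb Y$ be structures of the same relational language. Then (a) $\mathbb X\cong\mathbb Y\;\Rightarrow\;\mathbb P(\mathbb X)\cong\mathbb P(\mathbb Y)$; (b) $\mathbb X\rightleftarrows\mathbb Y\;\Rightarrow\;\operatorname{ro}\operatorname{sq}\mathbb P(\mathbb X)\cong\operatorname{ro}\operatorname{sq}\mathbb P(\mathbb Y)$.
   Context: For a relational language $L=\langle R_i:i\in I\rangle$ with arities $n_i\ge1$, an $L$-structure is $\mathbb X=\langle X,\langle\rho_i:i\in I\rangle\rangle$ with $X\neq\emptyset$, $\rho_i\subset X^{n_i}$. An embedding $f:\mathbb X\hookrightarrow\mathbb Y=\langle Y,\langle\sigma_i:i\in I\rangle\rangle$ is an injection $f:X\to Y$ with $\langle x_1,\dots,x_{n_i}\rangle\in\rho_i\Leftrightarrow\langle f(x_1),\dots,f(x_{n_i})\rangle\in\sigma_i$ for all $i\in I$ and all $x_1,\dots,x_{n_i}\in X$. $\mathbb X\cong\mathbb Y$ means there is a surjective embedding; $\mathbb X\rightleftarrows\mathbb Y$ (equimorphic) means each embeds in the other. $\mathbb P(\mathbb X)=\{f[X]:f:\mathbb X\hookrightarrow\mathbb X\}$, regarded as a poset ordered by $\subset$. For a partial order $\mathbb P=\langle P,\le\rangle$ let $p\le^* q$ iff $\forall r\le p\,\exists s\le r\; s\le q$, and $p=^*q$ iff $p\le^*q$ and $q\le^*p$. The separative quotient $\operatorname{sq}\mathbb P$ is the separative partial order $P/{=^*}$ with $[p]\trianglelefteq[q]\Leftrightarrow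 p\le^*q$. For a separative partial order $\mathbb Q$, $\operatorname{ro}\mathbb Q$ is its Boolean completion (the complete Boolean algebra, unique up to isomorphism, in whose set of non-zero elements $\mathbb Q$ is isomorphic to a dense suborder). *)

theory Defs
  imports "HOL-Algebra.Complete_Lattice"
begin

section \<open>Relational structures\<close>

record 'i language =
  symbols :: "'i set"
  arity :: "'i \<Rightarrow> nat"

definition relational_language :: "'i language \<Rightarrow> bool" where
  "relational_language L \<longleftrightarrow> (\<forall>i \<in> symbols L. arity L i \<ge> 1)"

text \<open>A tuple over a set \<open>A\<close> is a list of the right length with entries in \<open>A\<close>.\<close>

definition tuples :: "nat \<Rightarrow> 'a set \<Rightarrow> 'a list set" where
  "tuples n A = {xs. length xs = n \<and> set xs \<subseteq> A}"

record ('i, 'a) rel_structure =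
  universe :: "'a set"
  interp :: "'i \<Rightarrow> 'a list set"

definition is_structure :: "'i language \<Rightarrow> ('i, 'a) rel_structure \<Rightarrow> bool" where
  "is_structure L X \<longleftrightarrow>
     universe X \<noteq> {} \<and> (\<forall>i \<in> symbols L. interp X i \<subseteq> tuples (arity L i) (universe X))"

text \<open>HOL functions are total, so only the values of \<open>f\<close> on the universe of \<open>X\<close> matter.\<close>

definition embedding ::
    "'i language \<Rightarrow> ('i, 'a) rel_structure \<Rightarrow> ('i, 'b) rel_structure \<Rightarrow> ('a \<Rightarrow> 'b) \<Rightarrow> bool" where
  "embedding L X Y f \<longleftrightarrow>
     f \<in> universe X \<rightarrow> universe Y \<and> inj_on f (universe X) \<and>
     (\<forall>i \<in> symbols L. \<forall>xs \<in> tuples (arity L i) (universe X).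
        xs \<in> interp X i \<longleftrightarrow> map f xs \<in> interp Y i)"

definition isomorphic_structures ::
    "'i language \<Rightarrow> ('i, 'a) rel_structure \<Rightarrow> ('i, 'b) rel_structure \<Rightarrow> bool" where
  "isomorphic_structures L X Y \<longleftrightarrow> (\<exists>f. embedding L X Y f \<and> f ` universe X = universe Y)"

definition equimorphic ::
    "'i language \<Rightarrow> ('i, 'a) rel_structure \<Rightarrow> ('i, 'b) rel_structure \<Rightarrow> bool" where
  "equimorphic L X Y \<longleftrightarrow> (\<exists>f. embedding L X Y f) \<and> (\<exists>g. embedding L Y X g)"

definition copies :: "'i language \<Rightarrow> ('i, 'a) rel_structure \<Rightarrow> 'a set gorder" where
  "copies L X =
     \<lparr>carrier = {f ` universe X | f. embedding L X X f}, eq = (=), le = (\<subseteq>)\<rparr>"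


section \<open>Partial orders\<close>

text \<open>\<^const>\<open>order_emb\<close> does not mention the carrier of the target.\<close>

definition order_isomorphic :: "'p gorder \<Rightarrow> 'q gorder \<Rightarrow> bool" where
  "order_isomorphic P Q \<longleftrightarrow> (\<exists>f. bij_betw f (carrier P) (carrier Q) \<and> order_emb P Q f)"

definition le_star :: "('p, 'z) gorder_scheme \<Rightarrow> 'p \<Rightarrow> 'p \<Rightarrow> bool" where
  "le_star P p q \<longleftrightarrow>
     (\<forall>r \<in> carrier P. r \<sqsubseteq>\<^bsub>P\<^esub> p \<longrightarrow> (\<exists>s \<in> carrier P. s \<sqsubseteq>\<^bsub>P\<^esub> r \<and> s \<sqsubseteq>\<^bsub>P\<^esub> q))"

definition eq_star :: "('p, 'z) gorder_scheme \<Rightarrow> ('p \<times> 'p) set" where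
  "eq_star P =
     {(p, q). p \<in> carrier P \<and> q \<in> carrier P \<and> le_star P p q \<and> le_star P q p}"

text \<open>The order on classes does not depend on the representatives; see
  \<open>sq_le_iff\<close> below.\<close>

definition sq :: "('p, 'z) gorder_scheme \<Rightarrow> 'p set gorder" where
  "sq P =
     \<lparr>carrier = carrier P // eq_star P, eq = (=),
      le = (\<lambda>A B. \<exists>p \<in> A. \<exists>q \<in> B. le_star P p q)\<rparr>"

locale separative_order = partial_order Q for Q :: "'p gorder" (structure) +
  assumes separative:
    "\<lbrakk>p \<in> carrier Q; q \<in> carrier Q; le_star Q p q\<rbrakk> \<Longrightarrow> p \<sqsubseteq> q"

text \<open>The type class \<^class>\<open>complete_boolean_algebra\<close> cannot serve here: it demands complete
  distributivity, which makes every instance atomic.\<close>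

locale complete_boolean_lattice = complete_lattice B for B :: "'b gorder" (structure) +
  assumes meet_join_distrib:
      "\<lbrakk>x \<in> carrier B; y \<in> carrier B; z \<in> carrier B\<rbrakk>
        \<Longrightarrow> x \<sqinter> (y \<squnion> z) = (x \<sqinter> y) \<squnion> (x \<sqinter> z)"
    and complement_exists:
      "x \<in> carrier B \<Longrightarrow> \<exists>y \<in> carrier B. x \<sqinter> y = \<bottom> \<and> x \<squnion> y = \<top>"

definition dense_below :: "'p gorder \<Rightarrow> 'p set \<Rightarrow> 'p set \<Rightarrow> bool" where
  "dense_below B D A \<longleftrightarrow> D \<subseteq> A \<and> (\<forall>a \<in> A. \<exists>d \<in> D. d \<sqsubseteq>\<^bsub>B\<^esub> a)"

definition boolean_completion :: "'p gorder \<Rightarrow> 'b gorder \<Rightarrow> bool" where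
  "boolean_completion Q B \<longleftrightarrow>
     complete_boolean_lattice B \<and>
     (\<exists>e. order_emb Q B e \<and> dense_below B (e ` carrier Q) (carrier B - {\<bottom>\<^bsub>B\<^esub>}))"

text \<open>The type \<open>'p set\<close> is large enough to carry a completion of every separative order on \<open>'p\<close>,
  and any two completions, on whatever types, are isomorphic: see \<open>boolean_completion_ro\<close>
  and \<open>boolean_completion_unique\<close> below.\<close>

definition ro :: "'p gorder \<Rightarrow> 'p set gorder" where
  "ro Q = (SOME B. boolean_completion Q B)"


section \<open>The notions are well defined\<close>

lemma partial_order_copies: "partial_order (copies L X)"
  by unfold_locales (auto simp: copies_def)

context partial_order
begin

lemma le_star_refl: "p \<in> carrier L \<Longrightarrow> le_star L p p"
  by (auto simp: le_star_def)

lemma le_imp_le_star: "\<lbrakk>p \<sqsubseteq> q; p \<in> carrier L; q \<in> carrier L\<rbrakk> \<Longrightarrow> le_star L p q"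
  unfolding le_star_def by (meson le_refl le_trans)

lemma le_star_trans:
  assumes "le_star L p q" "le_star L q r" "p \<in> carrier L" "q \<in> carrier L" "r \<in> carrier L"
  shows "le_star L p r"
  unfolding le_star_def
proof (intro ballI impI)
  fix x assume x: "x \<in> carrier L" "x \<sqsubseteq> p"
  obtain s where s: "s \<in> carrier L" "s \<sqsubseteq> x" "s \<sqsubseteq> q"
    using assms(1) x unfolding le_star_def by blast
  obtain t where t: "t \<in> carrier L" "t \<sqsubseteq> s" "t \<sqsubseteq> r"
    using assms(2) s unfolding le_star_def by blast
  show "\<exists>s\<in>carrier L. s \<sqsubseteq> x \<and> s \<sqsubseteq> r"
    using s t x le_trans by blast
qed

lemma equiv_eq_star: "equiv (carrier L) (eq_star L)"
proof (rule equivI)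
  show "eq_star L \<subseteq> carrier L \<times> carrier L" by (auto simp: eq_star_def)
  show "refl_on (carrier L) (eq_star L)"
    by (auto simp: refl_on_def eq_star_def le_star_refl)
  show "sym (eq_star L)" by (auto simp: sym_def eq_star_def)
  show "trans (eq_star L)"
    by (auto simp: trans_def eq_star_def intro: le_star_trans)
qed

lemma sq_le_iff:
  assumes p: "p \<in> carrier L" and q: "q \<in> carrier L"
  shows "eq_star L `` {p} \<sqsubseteq>\<^bsub>sq L\<^esub> eq_star L `` {q} \<longleftrightarrow> le_star L p q"
proof
  assume "eq_star L `` {p} \<sqsubseteq>\<^bsub>sq L\<^esub> eq_star L `` {q}"
  then obtain p' q' where *: "(p, p') \<in> eq_star L" "(q, q') \<in> eq_star L" "le_star L p' q'"
    by (auto simp: sq_def)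
  then show "le_star L p q"
    unfolding eq_star_def by (auto intro: le_star_trans)
next
  assume "le_star L p q"
  moreover have "(p, p) \<in> eq_star L" "(q, q) \<in> eq_star L"
    using p q le_star_refl by (auto simp: eq_star_def)
  ultimately show "eq_star L `` {p} \<sqsubseteq>\<^bsub>sq L\<^esub> eq_star L `` {q}"
    by (auto simp: sq_def)
qed

lemma carrier_sqE:
  assumes "A \<in> carrier (sq L)"
  obtains p where "p \<in> carrier L" "A = eq_star L `` {p}"
  using assms by (auto simp: sq_def elim: quotientE)

lemma class_in_carrier_sq: "p \<in> carrier L \<Longrightarrow> eq_star L `` {p} \<in> carrier (sq L)"
  by (auto simp: sq_def intro: quotientI)

lemma separative_order_sq: "separative_order (sq L)"
proof -
  interpret S: partial_order "sq L"
  proof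
    show "(.=\<^bsub>sq L\<^esub>) = (=)" by (simp add: sq_def)
  next
    fix A assume "A \<in> carrier (sq L)"
    then show "A \<sqsubseteq>\<^bsub>sq L\<^esub> A" by (metis carrier_sqE sq_le_iff le_star_refl)
  next
    fix A B assume "A \<sqsubseteq>\<^bsub>sq L\<^esub> B" "B \<sqsubseteq>\<^bsub>sq L\<^esub> A" "A \<in> carrier (sq L)" "B \<in> carrier (sq L)"
    then obtain p q where pq: "p \<in> carrier L" "q \<in> carrier L"
        "A = eq_star L `` {p}" "B = eq_star L `` {q}" "le_star L p q" "le_star L q p"
      by (metis carrier_sqE sq_le_iff)
    then have "(p, q) \<in> eq_star L" by (simp add: eq_star_def)
    then have "A = B" using pq equiv_class_eq[OF equiv_eq_star] by blast
    then show "A .=\<^bsub>sq L\<^esub> B" by (simp add: sq_def)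
  next
    fix A B C
    assume "A \<sqsubseteq>\<^bsub>sq L\<^esub> B" "B \<sqsubseteq>\<^bsub>sq L\<^esub> C"
      "A \<in> carrier (sq L)" "B \<in> carrier (sq L)" "C \<in> carrier (sq L)"
    then show "A \<sqsubseteq>\<^bsub>sq L\<^esub> C"
      by (metis carrier_sqE sq_le_iff le_star_trans)
  qed (simp_all add: sq_def)
  show ?thesis
  proof
    fix A B
    assume "A \<in> carrier (sq L)" "B \<in> carrier (sq L)" and le: "le_star (sq L) A B"
    obtain p where p: "p \<in> carrier L" "A = eq_star L `` {p}"
      using carrier_sqE[OF \<open>A \<in> _\<close>] .
    obtain q where q: "q \<in> carrier L" "B = eq_star L `` {q}"
      using carrier_sqE[OF \<open>B \<in> _\<close>] .
    note pq = p q
    have "le_star L p q"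
      unfolding le_star_def
    proof (intro ballI impI)
      fix r assume r: "r \<in> carrier L" "r \<sqsubseteq> p"
      have "eq_star L `` {r} \<sqsubseteq>\<^bsub>sq L\<^esub> A"
        using r pq by (simp add: sq_le_iff le_imp_le_star)
      then obtain S where S: "S \<in> carrier (sq L)" "S \<sqsubseteq>\<^bsub>sq L\<^esub> eq_star L `` {r}" "S \<sqsubseteq>\<^bsub>sq L\<^esub> B"
        using bspec[OF le[unfolded le_star_def] class_in_carrier_sq[OF r(1)]] by auto
      then obtain s where s: "s \<in> carrier L" "S = eq_star L `` {s}"
        using carrier_sqE by blast
      then have s: "s \<in> carrier L" "le_star L s r" "le_star L s q"
        using S r pq by (simp_all add: sq_le_iff)
      obtain t where t: "t \<in> carrier L" "t \<sqsubseteq> s" "t \<sqsubseteq> r"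
        using s le_refl unfolding le_star_def by blast
      obtain u where u: "u \<in> carrier L" "u \<sqsubseteq> t" "u \<sqsubseteq> q"
        using s t unfolding le_star_def by blast
      show "\<exists>s\<in>carrier L. s \<sqsubseteq> r \<and> s \<sqsubseteq> q"
        using r t u le_trans by blast
    qed
    then show "A \<sqsubseteq>\<^bsub>sq L\<^esub> B" using pq by (simp add: sq_le_iff)
  qed
qed

end

text \<open>Existence of the completion: the regular open sets of \<open>Q\<close>, that is, the sets that
  equal their double polar under incompatibility.\<close>

definition polar :: "('p, 'z) gorder_scheme \<Rightarrow> 'p set \<Rightarrow> 'p set" where
  "polar Q U = {p \<in> carrier Q. \<not> (\<exists>u \<in> U. \<exists>r \<in> carrier Q. r \<sqsubseteq>\<^bsub>Q\<^esub> p \<and> r \<sqsubseteq>\<^bsub>Q\<^esub> u)}"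

definition regular_open :: "('p, 'z) gorder_scheme \<Rightarrow> 'p set gorder" where
  "regular_open Q =
     \<lparr>carrier = {U. U \<subseteq> carrier Q \<and> polar Q (polar Q U) = U}, eq = (=), le = (\<subseteq>)\<rparr>"

lemma polar_subset: "polar Q U \<subseteq> carrier Q"
  by (auto simp: polar_def)

lemma polar_in_carrier: "p \<in> polar Q U \<Longrightarrow> p \<in> carrier Q"
  by (simp add: polar_def)

lemma polar_antimono: "U \<subseteq> V \<Longrightarrow> polar Q V \<subseteq> polar Q U"
  by (auto simp: polar_def)

lemma polar_polar_subset: "U \<subseteq> carrier Q \<Longrightarrow> U \<subseteq> polar Q (polar Q U)"
  by (auto simp: polar_def)

lemma polar_polar_polar: "U \<subseteq> carrier Q \<Longrightarrow> polar Q (polar Q (polar Q U)) = polar Q U"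
  by (meson polar_antimono polar_polar_subset polar_subset subset_antisym)

lemma regular_openI:
  "U \<subseteq> carrier Q \<Longrightarrow> polar Q (polar Q U) \<subseteq> U \<Longrightarrow> U \<in> carrier (regular_open Q)"
  using polar_polar_subset[of U Q] by (auto simp: regular_open_def)

lemma polar_regular_open: "U \<subseteq> carrier Q \<Longrightarrow> polar Q U \<in> carrier (regular_open Q)"
  by (simp add: regular_open_def polar_subset polar_polar_polar)

lemma regular_openD:
  "U \<in> carrier (regular_open Q) \<Longrightarrow> U \<subseteq> carrier Q"
  "U \<in> carrier (regular_open Q) \<Longrightarrow> polar Q (polar Q U) = U"
  by (auto simp: regular_open_def)

lemma le_regular_open [simp]: "U \<sqsubseteq>\<^bsub>regular_open Q\<^esub> V \<longleftrightarrow> U \<subseteq> V"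
  by (simp add: regular_open_def)

lemma partial_order_regular_open: "partial_order (regular_open Q)"
  by unfold_locales (auto simp: regular_open_def)

lemma lub_regular_open:
  assumes "\<A> \<subseteq> carrier (regular_open Q)"
  shows "is_lub (regular_open Q) (polar Q (polar Q (\<Union>\<A>))) \<A>"
proof -
  have sub: "\<Union>\<A> \<subseteq> carrier Q" using assms by (auto dest: regular_openD)
  have "polar Q (polar Q (\<Union>\<A>)) \<subseteq> V"
    if "V \<in> carrier (regular_open Q)" "\<Union>\<A> \<subseteq> V" for V
    using that by (metis polar_antimono regular_openD(2))
  moreover have "\<Union>\<A> \<subseteq> polar Q (polar Q (\<Union>\<A>))" using polar_polar_subset[OF sub] .
  moreover have "polar Q (polar Q (\<Union>\<A>)) \<in> carrier (regular_open Q)"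
    by (intro polar_regular_open polar_subset)
  ultimately show ?thesis
    unfolding least_def Upper_def le_regular_open
    using assms by (intro conjI ballI) (auto simp: Sup_le_iff subset_iff[of \<A>])
qed

lemma glb_regular_open:
  assumes "\<A> \<subseteq> carrier (regular_open Q)"
  shows "is_glb (regular_open Q) (carrier Q \<inter> \<Inter>\<A>) \<A>"
proof -
  have "polar Q (polar Q (carrier Q \<inter> \<Inter>\<A>)) \<subseteq> U" if "U \<in> \<A>" for U
  proof -
    have "carrier Q \<inter> \<Inter>\<A> \<subseteq> U" using that by auto
    then show ?thesis using that assms by (metis polar_antimono regular_openD(2) subsetD)
  qed
  then have "carrier Q \<inter> \<Inter>\<A> \<in> carrier (regular_open Q)"
    by (intro regular_openI) (fastforce dest: polar_in_carrier)+
  then show ?thesis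
    using assms by (auto simp: greatest_def Lower_def dest: regular_openD)
qed

lemma complete_lattice_regular_open: "complete_lattice (regular_open Q)"
proof -
  interpret partial_order "regular_open Q" by (rule partial_order_regular_open)
  show ?thesis
    by unfold_locales (meson lub_regular_open glb_regular_open)+
qed

lemma (in partial_order) sup_eqI: "is_lub L x A \<Longrightarrow> \<Squnion>A = x"
  unfolding sup_def by (rule someI2) (auto intro: least_unique)

lemma (in partial_order) inf_eqI: "is_glb L x A \<Longrightarrow> \<Sqinter>A = x"
  unfolding inf_def by (rule someI2) (auto intro: greatest_unique)

lemma (in partial_order) bottom_eqI: "least L x (carrier L) \<Longrightarrow> \<bottom> = x"
  unfolding bottom_def by (rule someI2) (auto intro: least_unique)

lemma (in partial_order) top_eqI: "greatest L x (carrier L) \<Longrightarrow> \<top> = x"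
  unfolding top_def by (rule someI2) (auto intro: greatest_unique)

context partial_order
begin

lemma polar_down: "\<lbrakk>p \<in> polar L U; q \<in> carrier L; q \<sqsubseteq> p\<rbrakk> \<Longrightarrow> q \<in> polar L U"
  unfolding polar_def by (auto intro: le_trans)

lemma regular_open_down:
  "\<lbrakk>U \<in> carrier (regular_open L); p \<in> U; q \<in> carrier L; q \<sqsubseteq> p\<rbrakk> \<Longrightarrow> q \<in> U"
  by (metis polar_down regular_openD(2))

lemma polar_disjoint: "\<lbrakk>p \<in> polar L U; p \<in> U\<rbrakk> \<Longrightarrow> False"
  unfolding polar_def by auto

lemma join_regular_open:
  "\<lbrakk>U \<in> carrier (regular_open L); V \<in> carrier (regular_open L)\<rbrakk>
    \<Longrightarrow> U \<squnion>\<^bsub>regular_open L\<^esub> V = polar L (polar L (U \<union> V))"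
  unfolding join_def
  using partial_order.sup_eqI[OF partial_order_regular_open lub_regular_open, of "{U, V}" L]
  by simp

lemma meet_regular_open:
  "\<lbrakk>U \<in> carrier (regular_open L); V \<in> carrier (regular_open L)\<rbrakk>
    \<Longrightarrow> U \<sqinter>\<^bsub>regular_open L\<^esub> V = U \<inter> V"
  unfolding meet_def
  using partial_order.inf_eqI[OF partial_order_regular_open glb_regular_open, of "{U, V}" L]
  by (auto dest: regular_openD)

lemma bottom_regular_open: "\<bottom>\<^bsub>regular_open L\<^esub> = {}"
proof (rule partial_order.bottom_eqI[OF partial_order_regular_open])
  have "polar L (polar L {}) = {}"
    by (auto simp: polar_def)
  then show "least (regular_open L) {} (carrier (regular_open L))"
    by (auto simp: least_def regular_open_def)
qed

lemma top_regular_open: "\<top>\<^bsub>regular_open L\<^esub> = carrier L"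
proof (rule partial_order.top_eqI[OF partial_order_regular_open])
  have "carrier L \<in> carrier (regular_open L)"
    by (intro regular_openI) (auto dest: polar_in_carrier)
  then show "greatest (regular_open L) (carrier L) (carrier (regular_open L))"
    by (auto simp: greatest_def regular_open_def)
qed

lemma Int_regular_open:
  "\<lbrakk>U \<in> carrier (regular_open L); V \<in> carrier (regular_open L)\<rbrakk>
    \<Longrightarrow> U \<inter> V \<in> carrier (regular_open L)"
  using polar_antimono[OF polar_antimono[OF Int_lower1[of U V]], of L L]
    polar_antimono[OF polar_antimono[OF Int_lower2[of U V]], of L L]
  by (intro regular_openI) (auto dest: regular_openD(1) simp: regular_openD(2))

lemma complete_boolean_lattice_regular_open: "complete_boolean_lattice (regular_open L)"
proof -
  interpret R: complete_lattice "regular_open L" by (rule complete_lattice_regular_open)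
  show ?thesis
  proof
    fix U V W
    assume U: "U \<in> carrier (regular_open L)"
      and V: "V \<in> carrier (regular_open L)" and W: "W \<in> carrier (regular_open L)"
    have "U \<inter> polar L (polar L (V \<union> W)) = polar L (polar L (U \<inter> V \<union> U \<inter> W))" (is "?l = ?r")
    proof
      show "?l \<subseteq> ?r"
      proof
        fix p assume p: "p \<in> ?l"
        then have pc: "p \<in> carrier L" by (blast dest: polar_in_carrier)
        have False
          if w: "w \<in> polar L (U \<inter> V \<union> U \<inter> W)" and r: "r \<in> carrier L" "r \<sqsubseteq> p" "r \<sqsubseteq> w" for w r
        proof -
          have rU: "r \<in> U" using p r U regular_open_down by blast
          have "r \<in> polar L (polar L (V \<union> W))" using p r polar_down by blast
          then have "r \<notin> polar L (V \<union> W)" using polar_disjoint by blast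
          then obtain y s where ys: "y \<in> V \<union> W" "s \<in> carrier L" "s \<sqsubseteq> r" "s \<sqsubseteq> y"
            using r by (auto simp: polar_def)
          then have s: "s \<in> V \<union> W" "s \<in> U"
            using V W U rU regular_open_down by blast+
          have "r \<in> polar L (U \<inter> V \<union> U \<inter> W)" using w r polar_down by blast
          then have "s \<in> polar L (U \<inter> V \<union> U \<inter> W)" using ys polar_down by blast
          then show False using s polar_disjoint by blast
        qed
        then show "p \<in> ?r" using pc by (auto simp: polar_def[of L "polar L _"])
      qed
      have "?r \<subseteq> polar L (polar L U)" by (intro polar_antimono) auto
      moreover have "?r \<subseteq> polar L (polar L (V \<union> W))" by (intro polar_antimono) auto
      ultimately show "?r \<subseteq> ?l" using regular_openD(2)[OF U] by auto
    qed
    moreover have "polar L (polar L (V \<union> W)) \<in> carrier (regular_open L)"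
      by (intro polar_regular_open polar_subset)
    ultimately show "U \<sqinter>\<^bsub>regular_open L\<^esub> (V \<squnion>\<^bsub>regular_open L\<^esub> W)
        = U \<sqinter>\<^bsub>regular_open L\<^esub> V \<squnion>\<^bsub>regular_open L\<^esub> U \<sqinter>\<^bsub>regular_open L\<^esub> W"
      using U V W by (simp add: join_regular_open meet_regular_open Int_regular_open)
  next
    fix U assume U: "U \<in> carrier (regular_open L)"
    have P: "polar L U \<in> carrier (regular_open L)"
      using U by (intro polar_regular_open regular_openD)
    have 1: "U \<inter> polar L U = {}" using polar_disjoint by blast
    have "polar L (U \<union> polar L U) = {}"
      using polar_antimono[of U "U \<union> polar L U" L] polar_disjoint[of _ "U \<union> polar L U"] by blast
    then have 2: "polar L (polar L (U \<union> polar L U)) = carrier L"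
      by (simp add: polar_def[of L "{}"])
    show "\<exists>V\<in>carrier (regular_open L). U \<sqinter>\<^bsub>regular_open L\<^esub> V = \<bottom>\<^bsub>regular_open L\<^esub>
        \<and> U \<squnion>\<^bsub>regular_open L\<^esub> V = \<top>\<^bsub>regular_open L\<^esub>"
    proof (intro bexI[OF _ P] conjI)
      show "U \<sqinter>\<^bsub>regular_open L\<^esub> polar L U = \<bottom>\<^bsub>regular_open L\<^esub>"
        unfolding meet_regular_open[OF U P] bottom_regular_open by (rule 1)
      show "U \<squnion>\<^bsub>regular_open L\<^esub> polar L U = \<top>\<^bsub>regular_open L\<^esub>"
        unfolding join_regular_open[OF U P] top_regular_open by (rule 2)
    qed
  qed
qed

end

lemma (in separative_order) boolean_completion_regular_open:
  "boolean_completion Q (regular_open Q)"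
proof -
  define e where "e p = {q \<in> carrier Q. q \<sqsubseteq> p}" for p
  have reg: "e p \<in> carrier (regular_open Q)" if p: "p \<in> carrier Q" for p
  proof (rule regular_openI)
    show "e p \<subseteq> carrier Q" by (auto simp: e_def)
    show "polar Q (polar Q (e p)) \<subseteq> e p"
    proof
      fix q assume q: "q \<in> polar Q (polar Q (e p))"
      then have qc: "q \<in> carrier Q" by (blast dest: polar_in_carrier)
      have "le_star Q q p"
        unfolding le_star_def
      proof (intro ballI impI)
        fix r assume r: "r \<in> carrier Q" "r \<sqsubseteq> q"
        then have "r \<in> polar Q (polar Q (e p))" using q polar_down by blast
        then have "r \<notin> polar Q (e p)" using polar_disjoint by blast
        then obtain u s where us: "u \<in> e p" "s \<in> carrier Q" "s \<sqsubseteq> r" "s \<sqsubseteq> u"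
          using r by (auto simp: polar_def)
        then show "\<exists>s\<in>carrier Q. s \<sqsubseteq> r \<and> s \<sqsubseteq> p"
          using p by (auto simp: e_def intro: le_trans)
      qed
      then show "q \<in> e p" using separative qc p by (simp add: e_def)
    qed
  qed
  have emb: "order_emb Q (regular_open Q) e"
    unfolding order_emb_def
    using weak_partial_order_axioms partial_order.axioms(1)[OF partial_order_regular_open]
    by (auto simp: e_def intro: le_trans)
  have "dense_below (regular_open Q) (e ` carrier Q) (carrier (regular_open Q) - {{}})"
    unfolding dense_below_def
  proof (intro conjI ballI)
    show "e ` carrier Q \<subseteq> carrier (regular_open Q) - {{}}"
      using reg by (auto simp: e_def)
    fix U assume U: "U \<in> carrier (regular_open Q) - {{}}"
    then obtain p where p: "p \<in> U" by auto
    then have "p \<in> carrier Q" using U by (auto dest: regular_openD)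
    moreover have "e p \<subseteq> U"
      using p U regular_open_down by (auto simp: e_def)
    ultimately show "\<exists>d\<in>e ` carrier Q. d \<sqsubseteq>\<^bsub>regular_open Q\<^esub> U" by auto
  qed
  then show ?thesis
    unfolding boolean_completion_def
    using emb complete_boolean_lattice_regular_open bottom_regular_open by auto
qed

lemma boolean_completion_ro: "separative_order Q \<Longrightarrow> boolean_completion Q (ro Q)"
  unfolding ro_def
  by (rule someI[where P = "boolean_completion Q"])
    (rule separative_order.boolean_completion_regular_open)

lemma order_isomorphicI:
  assumes "partial_order P" "weak_partial_order Q" "f ` carrier P = carrier Q"
    and "\<And>x y. \<lbrakk>x \<in> carrier P; y \<in> carrier P\<rbrakk> \<Longrightarrow> f x \<sqsubseteq>\<^bsub>Q\<^esub> f y \<longleftrightarrow> x \<sqsubseteq>\<^bsub>P\<^esub> y"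
  shows "order_isomorphic P Q"
proof -
  interpret P: partial_order P by fact
  interpret Q: weak_partial_order Q by fact
  have "x = y" if "x \<in> carrier P" "y \<in> carrier P" "f x = f y" for x y
  proof -
    have "f y \<sqsubseteq>\<^bsub>Q\<^esub> f y" using assms(3) that(2) by (intro Q.le_refl) blast
    then have "x \<sqsubseteq>\<^bsub>P\<^esub> y" "y \<sqsubseteq>\<^bsub>P\<^esub> x" using that assms(4) by metis+
    then show ?thesis using that(1,2) by (rule P.le_antisym)
  qed
  then show ?thesis
    unfolding order_isomorphic_def bij_betw_def inj_on_def order_emb_def
    using assms P.weak_partial_order_axioms by blast
qed

lemma order_isomorphic_sym:
  assumes "order_isomorphic P Q"
  shows "order_isomorphic Q P"
proof -
  obtain f where f: "bij_betw f (carrier P) (carrier Q)" "order_emb P Q f"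
    using assms(1) by (auto simp: order_isomorphic_def)
  let ?g = "inv_into (carrier P) f"
  have g: "bij_betw ?g (carrier Q) (carrier P)" using f(1) by (rule bij_betw_inv_into)
  have "?g x \<sqsubseteq>\<^bsub>P\<^esub> ?g y \<longleftrightarrow> x \<sqsubseteq>\<^bsub>Q\<^esub> y" if "x \<in> carrier Q" "y \<in> carrier Q" for x y
    using f(2) that bij_betw_apply[OF g] bij_betw_inv_into_right[OF f(1)]
    unfolding order_emb_def by metis
  then show ?thesis
    using f(2) g unfolding order_isomorphic_def order_emb_def by blast
qed

lemma order_isomorphic_trans:
  assumes "order_isomorphic P Q" "order_isomorphic Q R"
  shows "order_isomorphic P R"
proof -
  obtain f where f: "bij_betw f (carrier P) (carrier Q)" "order_emb P Q f"
    using assms(1) by (auto simp: order_isomorphic_def)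
  obtain g where g: "bij_betw g (carrier Q) (carrier R)" "order_emb Q R g"
    using assms(2) by (auto simp: order_isomorphic_def)
  have "order_emb P R (g \<circ> f)"
    using f g bij_betw_apply[OF f(1)] unfolding order_emb_def by simp
  then show ?thesis
    using bij_betw_trans[OF f(1) g(1)] unfolding order_isomorphic_def by blast
qed

context complete_boolean_lattice
begin

lemma le_complement:
  assumes "x \<in> carrier B" "y \<in> carrier B" "c \<in> carrier B" "y \<squnion> c = \<top>" "x \<sqinter> y = \<bottom>"
  shows "x \<sqsubseteq> c"
proof -
  have "x \<sqsubseteq> x \<sqinter> (y \<squnion> c)"
    unfolding assms(4) using assms(1) by (intro meet_le) (auto intro: top_higher)
  also have "x \<sqinter> (y \<squnion> c) = \<bottom> \<squnion> (x \<sqinter> c)"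
    using meet_join_distrib[OF assms(1-3)] assms(5) by simp
  also have "\<dots> \<sqsubseteq> c"
    using assms by (intro join_le) (auto intro: bottom_lower meet_right)
  finally show ?thesis using assms by simp
qed

lemma le_bottom: "\<lbrakk>x \<in> carrier B; x \<sqsubseteq> \<bottom>\<rbrakk> \<Longrightarrow> x = \<bottom>"
  by (intro le_antisym) (auto intro: bottom_lower)

lemma not_le_witness:
  assumes "x \<in> carrier B" "y \<in> carrier B" "\<not> x \<sqsubseteq> y"
  shows "\<exists>z \<in> carrier B. z \<noteq> \<bottom> \<and> z \<sqsubseteq> x \<and>
    (\<forall>t \<in> carrier B. t \<sqsubseteq> z \<longrightarrow> t \<sqsubseteq> y \<longrightarrow> t = \<bottom>)"
proof -
  obtain c where c: "c \<in> carrier B" "y \<sqinter> c = \<bottom>" "y \<squnion> c = \<top>"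
    using complement_exists assms by blast
  have "x \<sqinter> c \<noteq> \<bottom>"
    using le_complement[of x c y] assms c by (auto simp: join_comm)
  moreover have "t = \<bottom>" if t: "t \<in> carrier B" "t \<sqsubseteq> x \<sqinter> c" "t \<sqsubseteq> y" for t
  proof -
    have "t \<sqsubseteq> c" using t(1,2) assms c(1) by (meson le_trans meet_closed meet_right)
    then have "t \<sqsubseteq> y \<sqinter> c" using t assms c(1) by (intro meet_le)
    then show "t = \<bottom>" using t(1) c(2) le_bottom by simp
  qed
  ultimately show ?thesis
    using assms c(1) by (intro bexI[of _ "x \<sqinter> c"]) (auto intro: meet_left)
qed

end

lemma boolean_completion_iso_regular_open:
  assumes Q: "partial_order Q" and comp: "boolean_completion Q B"
  shows "order_isomorphic B (regular_open Q)"
proof -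
  interpret Q: partial_order Q by (rule Q)
  interpret B: complete_boolean_lattice B using comp by (simp add: boolean_completion_def)
  obtain e where emb: "order_emb Q B e"
    and dense: "dense_below B (e ` carrier Q) (carrier B - {\<bottom>\<^bsub>B\<^esub>})"
    using comp by (auto simp: boolean_completion_def)
  have e_le: "e p \<sqsubseteq>\<^bsub>B\<^esub> e q \<longleftrightarrow> p \<sqsubseteq>\<^bsub>Q\<^esub> q" if "p \<in> carrier Q" "q \<in> carrier Q" for p q
    using emb that by (simp add: order_emb_def)
  have e_in: "e p \<in> carrier B" and e_ne: "e p \<noteq> \<bottom>\<^bsub>B\<^esub>" if "p \<in> carrier Q" for p
    using dense that by (auto simp: dense_below_def)
  have below: "\<exists>p \<in> carrier Q. e p \<sqsubseteq>\<^bsub>B\<^esub> b" if "b \<in> carrier B" "b \<noteq> \<bottom>\<^bsub>B\<^esub>" for b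
    using dense that by (auto simp: dense_below_def)
  have witness: "\<exists>p \<in> carrier Q. e p \<sqsubseteq>\<^bsub>B\<^esub> b \<and>
      (\<forall>s \<in> carrier Q. e s \<sqsubseteq>\<^bsub>B\<^esub> e p \<longrightarrow> \<not> e s \<sqsubseteq>\<^bsub>B\<^esub> b')"
    if bb': "b \<in> carrier B" "b' \<in> carrier B" "\<not> b \<sqsubseteq>\<^bsub>B\<^esub> b'" for b b'
  proof -
    obtain z where z: "z \<in> carrier B" "z \<noteq> \<bottom>\<^bsub>B\<^esub>" "z \<sqsubseteq>\<^bsub>B\<^esub> b"
        "\<And>t. \<lbrakk>t \<in> carrier B; t \<sqsubseteq>\<^bsub>B\<^esub> z; t \<sqsubseteq>\<^bsub>B\<^esub> b'\<rbrakk> \<Longrightarrow> t = \<bottom>\<^bsub>B\<^esub>"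
      using B.not_le_witness[OF bb'] by blast
    obtain p where p: "p \<in> carrier Q" "e p \<sqsubseteq>\<^bsub>B\<^esub> z" using below z by blast
    have "\<not> e s \<sqsubseteq>\<^bsub>B\<^esub> b'" if s: "s \<in> carrier Q" "e s \<sqsubseteq>\<^bsub>B\<^esub> e p" for s
      using z(4)[OF e_in[OF s(1)]] B.le_trans[OF s(2) p(2)] e_in e_ne s p z(1) by blast
    moreover have "e p \<sqsubseteq>\<^bsub>B\<^esub> b"
      using B.le_trans[OF p(2) z(3)] e_in p z(1) bb' by blast
    ultimately show ?thesis using p by blast
  qed
  define h where "h b = {q \<in> carrier Q. e q \<sqsubseteq>\<^bsub>B\<^esub> b}" for b
  have h_le: "h b \<subseteq> h b' \<longleftrightarrow> b \<sqsubseteq>\<^bsub>B\<^esub> b'" if bb': "b \<in> carrier B" "b' \<in> carrier B" for b b'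
  proof
    assume sub: "h b \<subseteq> h b'"
    show "b \<sqsubseteq>\<^bsub>B\<^esub> b'"
    proof (rule ccontr)
      assume "\<not> b \<sqsubseteq>\<^bsub>B\<^esub> b'"
      from witness[OF bb' this] show False
        using sub e_in B.le_refl by (auto simp: h_def)
    qed
  next
    assume "b \<sqsubseteq>\<^bsub>B\<^esub> b'"
    then show "h b \<subseteq> h b'" using bb' e_in by (auto simp: h_def intro: B.le_trans)
  qed
  have h_reg: "h b \<in> carrier (regular_open Q)" if b: "b \<in> carrier B" for b
  proof (rule regular_openI)
    show "h b \<subseteq> carrier Q" by (auto simp: h_def)
    show "polar Q (polar Q (h b)) \<subseteq> h b"
    proof
      fix q assume q: "q \<in> polar Q (polar Q (h b))"
      then have qc: "q \<in> carrier Q" by (rule polar_in_carrier)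
      show "q \<in> h b"
      proof (rule ccontr)
        assume "q \<notin> h b"
        then have "\<not> e q \<sqsubseteq>\<^bsub>B\<^esub> b" using qc by (simp add: h_def)
        from witness[OF e_in[OF qc] b this] obtain p where p: "p \<in> carrier Q" "e p \<sqsubseteq>\<^bsub>B\<^esub> e q"
          and no: "\<And>s. \<lbrakk>s \<in> carrier Q; e s \<sqsubseteq>\<^bsub>B\<^esub> e p\<rbrakk> \<Longrightarrow> \<not> e s \<sqsubseteq>\<^bsub>B\<^esub> b" by blast
        have "p \<in> polar Q (polar Q (h b))"
          using Q.polar_down[OF q] p qc e_le by blast
        then have "p \<notin> polar Q (h b)" using Q.polar_disjoint by blast
        then obtain u s where us: "u \<in> h b" "s \<in> carrier Q" "s \<sqsubseteq>\<^bsub>Q\<^esub> p" "s \<sqsubseteq>\<^bsub>Q\<^esub> u"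
          using p by (auto simp: polar_def)
        then have u: "u \<in> carrier Q" "e u \<sqsubseteq>\<^bsub>B\<^esub> b" by (auto simp: h_def)
        have "e s \<sqsubseteq>\<^bsub>B\<^esub> b"
          using B.le_trans[of "e s" "e u" b] us u e_le e_in b by blast
        then show False using no[of s] us p e_le by blast
      qed
    qed
  qed
  have h_surj: "\<exists>b \<in> carrier B. h b = U" if U: "U \<in> carrier (regular_open Q)" for U
  proof (intro bexI)
    have Uc: "U \<subseteq> carrier Q" using U by (rule regular_openD)
    have eU: "e ` U \<subseteq> carrier B" using Uc e_in by auto
    define b where "b = \<Squnion>\<^bsub>B\<^esub>(e ` U)"
    show b: "b \<in> carrier B" unfolding b_def using eU by (rule B.sup_closed)
    show "h b = U"
    proof
      show "U \<subseteq> h b"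
        using Uc eU by (auto simp: h_def b_def intro!: B.sup_upper)
      show "h b \<subseteq> U"
      proof
        fix q assume q: "q \<in> h b"
        then have qc: "q \<in> carrier Q" "e q \<sqsubseteq>\<^bsub>B\<^esub> b" by (auto simp: h_def)
        have False if w: "w \<in> polar Q U" and r: "r \<in> carrier Q" "r \<sqsubseteq>\<^bsub>Q\<^esub> q" "r \<sqsubseteq>\<^bsub>Q\<^esub> w" for w r
        proof -
          have rU: "r \<in> polar Q U" using Q.polar_down[OF w r(1,3)] .
          obtain c where c: "c \<in> carrier B" "e r \<sqinter>\<^bsub>B\<^esub> c = \<bottom>\<^bsub>B\<^esub>" "e r \<squnion>\<^bsub>B\<^esub> c = \<top>\<^bsub>B\<^esub>"
            using B.complement_exists e_in r by blast
          have "e u \<sqsubseteq>\<^bsub>B\<^esub> c" if u: "u \<in> U" for u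
          proof (rule B.le_complement[OF _ _ c(1,3)])
            show eu: "e u \<in> carrier B" and er: "e r \<in> carrier B" using eU u e_in r by auto
            show "e u \<sqinter>\<^bsub>B\<^esub> e r = \<bottom>\<^bsub>B\<^esub>"
            proof (rule ccontr)
              have m: "e u \<sqinter>\<^bsub>B\<^esub> e r \<in> carrier B" using eu er by simp
              assume "e u \<sqinter>\<^bsub>B\<^esub> e r \<noteq> \<bottom>\<^bsub>B\<^esub>"
              then obtain p where p: "p \<in> carrier Q" "e p \<sqsubseteq>\<^bsub>B\<^esub> e u \<sqinter>\<^bsub>B\<^esub> e r"
                using below[OF m] by blast
              have "e p \<sqsubseteq>\<^bsub>B\<^esub> e u"
                using B.le_trans[OF p(2) B.meet_left[OF eu er] e_in[OF p(1)] m eu] .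
              moreover have "e p \<sqsubseteq>\<^bsub>B\<^esub> e r"
                using B.le_trans[OF p(2) B.meet_right[OF eu er] e_in[OF p(1)] m er] .
              ultimately have "p \<sqsubseteq>\<^bsub>Q\<^esub> u" "p \<sqsubseteq>\<^bsub>Q\<^esub> r" using e_le p u Uc r by blast+
              then show False using rU u p by (auto simp: polar_def)
            qed
          qed
          then have "b \<sqsubseteq>\<^bsub>B\<^esub> c"
            unfolding b_def using c(1) eU by (intro B.sup_least) (auto simp: Upper_def)
          moreover have "e r \<sqsubseteq>\<^bsub>B\<^esub> b"
            using B.le_trans[OF _ qc(2) e_in[OF r(1)] e_in[OF qc(1)] b] e_le[OF r(1) qc(1)] r(2)
            by simp
          ultimately have "e r \<sqsubseteq>\<^bsub>B\<^esub> c" using B.le_trans[OF _ _ e_in[OF r(1)] b c(1)] by blast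
          then have "e r \<sqsubseteq>\<^bsub>B\<^esub> e r \<sqinter>\<^bsub>B\<^esub> c"
            using e_in r c(1) by (intro B.meet_le) auto
          then show False using c(2) e_in e_ne r B.le_bottom by auto
        qed
        then have "q \<in> polar Q (polar Q U)"
          using qc(1) by (auto simp: polar_def[of Q "polar Q _"])
        then show "q \<in> U" using regular_openD(2)[OF U] by simp
      qed
    qed
  qed
  show ?thesis
  proof (rule order_isomorphicI)
    show "partial_order B" by unfold_locales
    show "weak_partial_order (regular_open Q)"
      using partial_order_regular_open by (rule partial_order.axioms)
    show "h ` carrier B = carrier (regular_open Q)" using h_reg h_surj by (auto simp: image_iff)
    show "h x \<sqsubseteq>\<^bsub>regular_open Q\<^esub> h y \<longleftrightarrow> x \<sqsubseteq>\<^bsub>B\<^esub> y" if "x \<in> carrier B" "y \<in> carrier B" for x y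
      using h_le that by simp
  qed
qed

lemma boolean_completion_unique:
  assumes "partial_order Q" "boolean_completion Q B" "boolean_completion Q C"
  shows "order_isomorphic B C"
  by (rule order_isomorphic_trans[OF boolean_completion_iso_regular_open
        order_isomorphic_sym[OF boolean_completion_iso_regular_open]])
    (rule assms)+

corollary boolean_completion_ro_sq_copies:
  "boolean_completion (sq (copies L X)) (ro (sq (copies L X)))"
  by (intro boolean_completion_ro partial_order.separative_order_sq partial_order_copies)

end

theory Submission
  imports Defs
begin

text \<open>Part (b) is a Cantor-Bernstein argument. For a partial order \<open>P\<close>, the algebra
  \<open>ro (sq P)\<close> is the algebra of regular open sets of \<open>P\<close>, and this does not change when \<open>P\<close> is
  replaced by a dense suborder. Now \<open>\<P>(X)\<close> is dense in the family \<open>D\<^sub>X\<close> of all subsets of \<open>X\<close> that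
  contain a copy of \<open>X\<close>, equivalently of \<open>Y\<close>, and likewise for \<open>\<P>(Y)\<close> and \<open>D\<^sub>Y\<close>. Embeddings of \<open>X\<close>
  into \<open>Y\<close> and of \<open>Y\<close> into \<open>X\<close> induce isomorphisms of \<open>D\<^sub>X\<close> and \<open>D\<^sub>Y\<close> onto downward closed parts of
  each other, so these two orders contain isomorphic dense suborders.\<close>

section \<open>Regular open algebras along dense maps\<close>

text \<open>The assumptions make \<open>e\<close> a dense embedding in the sense of forcing: it
  preserves the order, reflects compatibility and has dense range, but it may identify elements.
  Preimages under \<open>e\<close> give the isomorphism, because regular openness is expressed by
  polars, which depend only on compatibility.\<close>

lemma order_isomorphic_regular_open:
  fixes P :: "'p gorder" and Q :: "'q gorder"
  assumes P: "partial_order P" and Q: "partial_order Q"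
    and e_in: "e \<in> carrier P \<rightarrow> carrier Q"
    and mono: "\<And>p p'. \<lbrakk>p \<in> carrier P; p' \<in> carrier P; p \<sqsubseteq>\<^bsub>P\<^esub> p'\<rbrakk> \<Longrightarrow> e p \<sqsubseteq>\<^bsub>Q\<^esub> e p'"
    and compat: "\<And>p p' q. \<lbrakk>p \<in> carrier P; p' \<in> carrier P; q \<in> carrier Q; q \<sqsubseteq>\<^bsub>Q\<^esub> e p; q \<sqsubseteq>\<^bsub>Q\<^esub> e p'\<rbrakk>
      \<Longrightarrow> \<exists>r \<in> carrier P. r \<sqsubseteq>\<^bsub>P\<^esub> p \<and> r \<sqsubseteq>\<^bsub>P\<^esub> p'"
    and dense: "\<And>q. q \<in> carrier Q \<Longrightarrow> \<exists>p \<in> carrier P. e p \<sqsubseteq>\<^bsub>Q\<^esub> q"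
  shows "order_isomorphic (regular_open Q) (regular_open P)"
proof -
  interpret P: partial_order P by (rule P)
  interpret Q: partial_order Q by (rule Q)
  define h where "h U = {p \<in> carrier P. e p \<in> U}" for U
  have e: "e p \<in> carrier Q" if "p \<in> carrier P" for p using e_in that by blast
  \<comment> \<open>Preimages commute with polars of downward closed sets. If \<open>e p\<close> has
    a common lower bound \<open>s\<close> with an element of \<open>U\<close>, then density yields
    \<open>e r\<close> below \<open>s\<close>, still in \<open>U\<close>, and \<open>compat\<close>
    makes \<open>p\<close> and \<open>r\<close> compatible in \<open>P\<close>.\<close>
  have polar_h: "polar P (h U) = h (polar Q U)"
    if U: "U \<subseteq> carrier Q" and down: "\<And>p q. \<lbrakk>p \<in> U; q \<in> carrier Q; q \<sqsubseteq>\<^bsub>Q\<^esub> p\<rbrakk> \<Longrightarrow> q \<in> U" for U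
  proof
    show "h (polar Q U) \<subseteq> polar P (h U)"
    proof
      fix p assume "p \<in> h (polar Q U)"
      then have p: "p \<in> carrier P" "e p \<in> polar Q U" by (auto simp: h_def)
      have False if "u \<in> h U" "r \<in> carrier P" "r \<sqsubseteq>\<^bsub>P\<^esub> p" "r \<sqsubseteq>\<^bsub>P\<^esub> u" for u r
        using that p(2) e[OF that(2)] mono[of r p] mono[of r u] p(1) by (auto simp: h_def polar_def)
      then show "p \<in> polar P (h U)" using p(1) by (auto simp: polar_def)
    qed
    show "polar P (h U) \<subseteq> h (polar Q U)"
    proof
      fix p assume p: "p \<in> polar P (h U)"
      then have pc: "p \<in> carrier P" by (rule polar_in_carrier)
      have False if s: "u \<in> U" "s \<in> carrier Q" "s \<sqsubseteq>\<^bsub>Q\<^esub> e p" "s \<sqsubseteq>\<^bsub>Q\<^esub> u" for u s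
      proof -
        have "s \<in> U" using down s by blast
        obtain r where r: "r \<in> carrier P" "e r \<sqsubseteq>\<^bsub>Q\<^esub> s" using dense s by blast
        then have "r \<in> h U" using down \<open>s \<in> U\<close> e by (auto simp: h_def)
        moreover have "e r \<sqsubseteq>\<^bsub>Q\<^esub> e p" using Q.le_trans[OF r(2) s(3)] e r(1) s(2) pc by simp
        then have "\<exists>t \<in> carrier P. t \<sqsubseteq>\<^bsub>P\<^esub> p \<and> t \<sqsubseteq>\<^bsub>P\<^esub> r"
          using compat[of p r "e r"] r(1) pc e by auto
        ultimately show False using p by (auto simp: polar_def)
      qed
      then show "p \<in> h (polar Q U)" using pc e by (auto simp: h_def polar_def)
    qed
  qed
  have h_reg: "h U \<in> carrier (regular_open P)" if U: "U \<in> carrier (regular_open Q)" for U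
  proof -
    have "polar P (polar P (h U)) = h (polar Q (polar Q U))"
      using polar_h[of U] polar_h[of "polar Q U"] regular_openD(1)[OF U] Q.regular_open_down[OF U]
        Q.polar_down[of _ U] polar_subset by metis
    then show ?thesis
      using regular_openD(2)[OF U] by (auto simp: regular_open_def h_def)
  qed
  have h_le: "h U \<subseteq> h V \<longleftrightarrow> U \<subseteq> V"
    if U: "U \<in> carrier (regular_open Q)" and V: "V \<in> carrier (regular_open Q)" for U V
  proof
    assume sub: "h U \<subseteq> h V"
    show "U \<subseteq> V"
    proof (rule subsetI, rule ccontr)
      fix q assume q: "q \<in> U" "q \<notin> V"
      then have "q \<in> carrier Q" using U regular_openD(1) by blast
      \<comment> \<open>Since \<open>V\<close> equals its double polar, a point outside
        \<open>V\<close> is compatible with some element \<open>w\<close> of the polar of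
        \<open>V\<close>. An image \<open>e r\<close> below the common lower bound then lies in
        \<open>U\<close>, hence in \<open>V\<close>, and also in that polar.\<close>
      then obtain w s where s: "w \<in> polar Q V" "s \<in> carrier Q" "s \<sqsubseteq>\<^bsub>Q\<^esub> q" "s \<sqsubseteq>\<^bsub>Q\<^esub> w"
        using q regular_openD(2)[OF V] unfolding polar_def[of Q "polar Q V"] by blast
      obtain r where r: "r \<in> carrier P" "e r \<sqsubseteq>\<^bsub>Q\<^esub> s" using dense s by blast
      have "s \<in> U" using Q.regular_open_down[OF U q(1) s(2,3)] .
      then have "e r \<in> U" using Q.regular_open_down[OF U _ e[OF r(1)] r(2)] by blast
      then have "e r \<in> V" using sub r by (auto simp: h_def)
      moreover have "e r \<in> polar Q V"
        using Q.polar_down[OF Q.polar_down[OF s(1,2,4)] e[OF r(1)] r(2)] .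
      ultimately show False using Q.polar_disjoint by blast
    qed
  qed (auto simp: h_def)
  \<comment> \<open>The witness is the polar of the image of \<open>polar P W\<close>. That image
    need not be downward closed, so \<open>polar_h\<close> does not apply to it; instead
    \<open>p\<close> and \<open>w\<close> are compatible exactly when \<open>e p\<close> and
    \<open>e w\<close> are, and the preimage is the double polar of \<open>W\<close>.\<close>
  have h_surj: "\<exists>U \<in> carrier (regular_open Q). h U = W" if W: "W \<in> carrier (regular_open P)" for W
  proof (intro bexI)
    have sub: "e ` polar P W \<subseteq> carrier Q" using e polar_in_carrier by fastforce
    then show "polar Q (e ` polar P W) \<in> carrier (regular_open Q)" by (rule polar_regular_open)
    have "e p \<in> polar Q (e ` polar P W) \<longleftrightarrow> p \<in> polar P (polar P W)" if p: "p \<in> carrier P" for p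
    proof -
      have "(\<exists>s \<in> carrier Q. s \<sqsubseteq>\<^bsub>Q\<^esub> e p \<and> s \<sqsubseteq>\<^bsub>Q\<^esub> e w) \<longleftrightarrow>
          (\<exists>r \<in> carrier P. r \<sqsubseteq>\<^bsub>P\<^esub> p \<and> r \<sqsubseteq>\<^bsub>P\<^esub> w)" if "w \<in> polar P W" for w
        using p polar_in_carrier[OF that] e mono compat by meson
      then show ?thesis using p e by (simp add: polar_def[of P "polar P W"] polar_def[of Q]) blast
    qed
    then have "h (polar Q (e ` polar P W)) = polar P (polar P W)"
      using polar_in_carrier by (fastforce simp: h_def)
    then show "h (polar Q (e ` polar P W)) = W" using regular_openD(2)[OF W] by simp
  qed
  show ?thesis
  proof (rule order_isomorphicI)
    show "partial_order (regular_open Q)" by (rule partial_order_regular_open)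
    show "weak_partial_order (regular_open P)"
      using partial_order_regular_open by (rule partial_order.axioms)
    show "h ` carrier (regular_open Q) = carrier (regular_open P)"
      using h_reg h_surj by blast
  qed (simp add: h_le)
qed

text \<open>Density puts some \<open>e r\<close> below any common lower bound of \<open>e p\<close>
  and \<open>e p'\<close>, and \<open>e\<close> reflects the order, so an order embedding with dense
  range reflects compatibility.\<close>

lemma order_isomorphic_regular_open_dense:
  fixes P :: "'p gorder" and Q :: "'q gorder"
  assumes P: "partial_order P" and Q: "partial_order Q"
    and e_in: "e \<in> carrier P \<rightarrow> carrier Q"
    and emb: "\<And>p p'. \<lbrakk>p \<in> carrier P; p' \<in> carrier P\<rbrakk> \<Longrightarrow> e p \<sqsubseteq>\<^bsub>Q\<^esub> e p' \<longleftrightarrow> p \<sqsubseteq>\<^bsub>P\<^esub> p'"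
    and dense: "\<And>q. q \<in> carrier Q \<Longrightarrow> \<exists>p \<in> carrier P. e p \<sqsubseteq>\<^bsub>Q\<^esub> q"
  shows "order_isomorphic (regular_open Q) (regular_open P)"
proof (rule order_isomorphic_regular_open[OF P Q e_in _ _ dense])
  interpret Q: partial_order Q by (rule Q)
  fix p p' q
  assume *: "p \<in> carrier P" "p' \<in> carrier P" "q \<in> carrier Q" "q \<sqsubseteq>\<^bsub>Q\<^esub> e p" "q \<sqsubseteq>\<^bsub>Q\<^esub> e p'"
  obtain r where r: "r \<in> carrier P" "e r \<sqsubseteq>\<^bsub>Q\<^esub> q" using dense * by blast
  then have "e r \<sqsubseteq>\<^bsub>Q\<^esub> e p" "e r \<sqsubseteq>\<^bsub>Q\<^esub> e p'"
    using Q.le_trans[OF r(2) *(4)] Q.le_trans[OF r(2) *(5)] * r(1) funcset_mem[OF e_in] by auto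
  then show "\<exists>r \<in> carrier P. r \<sqsubseteq>\<^bsub>P\<^esub> p \<and> r \<sqsubseteq>\<^bsub>P\<^esub> p'" using r * emb by blast
qed (simp add: emb)

text \<open>Any completion of \<open>sq P\<close> is isomorphic to the regular open algebra of
  \<open>sq P\<close>, so it remains to compare \<open>P\<close> with \<open>sq P\<close>. The class
  map is not injective in general, which calls for \<open>order_isomorphic_regular_open\<close>
  rather than the version for order embeddings.\<close>

lemma order_isomorphic_ro_sq:
  fixes P :: "'p gorder"
  assumes P: "partial_order P"
  shows "order_isomorphic (ro (sq P)) (regular_open P)"
proof -
  interpret P: partial_order P by (rule P)
  have sep: "separative_order (sq P)" by (rule P.separative_order_sq)
  then have po: "partial_order (sq P)" by (rule separative_order.axioms)
  have "order_isomorphic (regular_open (sq P)) (regular_open P)"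
  proof (rule order_isomorphic_regular_open[OF P po, where e = "\<lambda>p. eq_star P `` {p}"])
    show "(\<lambda>p. eq_star P `` {p}) \<in> carrier P \<rightarrow> carrier (sq P)"
      using P.class_in_carrier_sq by blast
  next
    fix p p' assume "p \<in> carrier P" "p' \<in> carrier P" "p \<sqsubseteq>\<^bsub>P\<^esub> p'"
    then show "eq_star P `` {p} \<sqsubseteq>\<^bsub>sq P\<^esub> eq_star P `` {p'}"
      by (simp add: P.sq_le_iff P.le_imp_le_star)
  next
    fix p p' A
    assume pp': "p \<in> carrier P" "p' \<in> carrier P"
      and A: "A \<in> carrier (sq P)" "A \<sqsubseteq>\<^bsub>sq P\<^esub> eq_star P `` {p}" "A \<sqsubseteq>\<^bsub>sq P\<^esub> eq_star P `` {p'}"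
    obtain s where s: "s \<in> carrier P" "A = eq_star P `` {s}" using A(1) P.carrier_sqE by blast
    then have le: "le_star P s p" "le_star P s p'" using A pp' P.sq_le_iff by blast+
    \<comment> \<open>A lower bound in the quotient only gives \<open>s\<close> below
      \<open>p\<close> and \<open>p'\<close> in the sense of \<open>le_star\<close>. The two
      relations are used in turn: the first yields \<open>t\<close> below \<open>s\<close> and
      \<open>p\<close>, the second, applied to \<open>t\<close>, yields \<open>u\<close> below
      \<open>p'\<close> as well.\<close>
    obtain t where t: "t \<in> carrier P" "t \<sqsubseteq>\<^bsub>P\<^esub> s" "t \<sqsubseteq>\<^bsub>P\<^esub> p"
      using le(1) s(1) P.le_refl unfolding le_star_def by blast
    obtain u where u: "u \<in> carrier P" "u \<sqsubseteq>\<^bsub>P\<^esub> t" "u \<sqsubseteq>\<^bsub>P\<^esub> p'"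
      using le(2) t unfolding le_star_def by blast
    show "\<exists>r\<in>carrier P. r \<sqsubseteq>\<^bsub>P\<^esub> p \<and> r \<sqsubseteq>\<^bsub>P\<^esub> p'"
      using P.le_trans[OF u(2) t(3)] u t pp' by blast
  next
    fix A assume A: "A \<in> carrier (sq P)"
    then obtain p where "p \<in> carrier P" "A = eq_star P `` {p}" using P.carrier_sqE by blast
    then show "\<exists>p\<in>carrier P. eq_star P `` {p} \<sqsubseteq>\<^bsub>sq P\<^esub> A"
      using P.sq_le_iff P.le_star_refl by blast
  qed
  then show ?thesis
    using boolean_completion_iso_regular_open[OF po boolean_completion_ro[OF sep]]
      order_isomorphic_trans by blast
qed

section \<open>A Cantor-Bernstein theorem for regular open algebras\<close>

lemma partial_order_suborder:
  fixes P :: "'p gorder"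
  assumes "partial_order P" "E \<subseteq> carrier P"
  shows "partial_order (P\<lparr>carrier := E\<rparr>)"
proof -
  interpret P: partial_order P by fact
  show ?thesis
  proof
    show "(.=\<^bsub>P\<lparr>carrier := E\<rparr>\<^esub>) = (=)" using P.eq_is_equal by simp
  next
    fix x y z
    assume "x \<in> carrier (P\<lparr>carrier := E\<rparr>)" "y \<in> carrier (P\<lparr>carrier := E\<rparr>)" "z \<in> carrier (P\<lparr>carrier := E\<rparr>)"
    then have E: "x \<in> carrier P" "y \<in> carrier P" "z \<in> carrier P" using assms(2) by auto
    show "x \<sqsubseteq>\<^bsub>P\<lparr>carrier := E\<rparr>\<^esub> z"
      if "x \<sqsubseteq>\<^bsub>P\<lparr>carrier := E\<rparr>\<^esub> y" "y \<sqsubseteq>\<^bsub>P\<lparr>carrier := E\<rparr>\<^esub> z"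
      using that P.le_trans[of x y z] E by simp
  next
    fix x y
    assume "x \<in> carrier (P\<lparr>carrier := E\<rparr>)" "y \<in> carrier (P\<lparr>carrier := E\<rparr>)"
    then have E: "x \<in> carrier P" "y \<in> carrier P" using assms(2) by auto
    show "x .=\<^bsub>P\<lparr>carrier := E\<rparr>\<^esub> y"
      if "x \<sqsubseteq>\<^bsub>P\<lparr>carrier := E\<rparr>\<^esub> y" "y \<sqsubseteq>\<^bsub>P\<lparr>carrier := E\<rparr>\<^esub> x"
      using that P.weak_le_antisym[of x y] E by simp
  next
    fix x assume "x \<in> carrier (P\<lparr>carrier := E\<rparr>)"
    then show "x \<sqsubseteq>\<^bsub>P\<lparr>carrier := E\<rparr>\<^esub> x" using assms(2) P.le_refl[of x] by auto
  qed (simp_all add: P.eq_is_equal)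
qed

lemma order_isomorphic_regular_open_Cantor_Bernstein:
  fixes P :: "'p gorder" and Q :: "'q gorder"
  assumes P: "partial_order P" and Q: "partial_order Q"
    and F: "F \<in> carrier P \<rightarrow> carrier Q"
    and F_emb: "\<And>p p'. \<lbrakk>p \<in> carrier P; p' \<in> carrier P\<rbrakk> \<Longrightarrow> F p \<sqsubseteq>\<^bsub>Q\<^esub> F p' \<longleftrightarrow> p \<sqsubseteq>\<^bsub>P\<^esub> p'"
    and F_down: "\<And>p q. \<lbrakk>p \<in> carrier P; q \<in> carrier Q; q \<sqsubseteq>\<^bsub>Q\<^esub> F p\<rbrakk> \<Longrightarrow> q \<in> F ` carrier P"
    and G: "G \<in> carrier Q \<rightarrow> carrier P"
    and G_emb: "\<And>q q'. \<lbrakk>q \<in> carrier Q; q' \<in> carrier Q\<rbrakk> \<Longrightarrow> G q \<sqsubseteq>\<^bsub>P\<^esub> G q' \<longleftrightarrow> q \<sqsubseteq>\<^bsub>Q\<^esub> q'"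
    and G_down: "\<And>q p. \<lbrakk>q \<in> carrier Q; p \<in> carrier P; p \<sqsubseteq>\<^bsub>P\<^esub> G q\<rbrakk> \<Longrightarrow> p \<in> G ` carrier Q"
  shows "order_isomorphic (regular_open P) (regular_open Q)"
proof -
  interpret P: partial_order P by (rule P)
  interpret Q: partial_order Q by (rule Q)
  \<comment> \<open>\<open>U\<close> collects the elements reached by iterating \<open>G \<circ> F\<close> from those incompatible with the range of
    \<open>G\<close>. The union of \<open>U\<close> and \<open>V\<close> is dense, and \<open>\<psi>\<close>, which is \<open>F\<close> on \<open>U\<close> and the inverse of \<open>G\<close>
    on \<open>V\<close>, maps it onto a dense suborder of \<open>Q\<close>.\<close>
  define U0 where "U0 = polar P (G ` carrier Q)"
  define U where "U = (\<Union>n. ((G \<circ> F) ^^ n) ` U0)"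
  define V where "V = polar P U \<inter> G ` carrier Q"
  define \<psi> where "\<psi> p = (if p \<in> U then F p else inv_into (carrier Q) G p)" for p
  have Fc: "F p \<in> carrier Q" if "p \<in> carrier P" for p using F that by blast
  have Gc: "G q \<in> carrier P" if "q \<in> carrier Q" for q using G that by blast
  \<comment> \<open>Each layer is downward closed. An element below \<open>G (F t)\<close> is pulled
    back through \<open>G\<close> and then through \<open>F\<close>, both ranges being downward
    closed, to an element \<open>x\<close> below \<open>t\<close>, which lies in the previous
    layer.\<close>
  have step: "((G \<circ> F) ^^ n) ` U0 \<subseteq> carrier P \<and>
      (\<forall>p \<in> ((G \<circ> F) ^^ n) ` U0. \<forall>q \<in> carrier P. q \<sqsubseteq>\<^bsub>P\<^esub> p \<longrightarrow> q \<in> ((G \<circ> F) ^^ n) ` U0)" for n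
  proof (induction n)
    case 0
    show ?case using P.polar_down[of _ "G ` carrier Q"] polar_in_carrier by (auto simp: U0_def)
  next
    case (Suc n)
    let ?T = "((G \<circ> F) ^^ n) ` U0"
    have eq: "((G \<circ> F) ^^ Suc n) ` U0 = G ` F ` ?T" by (auto simp: image_image)
    have "q \<in> G ` F ` ?T" if t: "t \<in> ?T" and q: "q \<in> carrier P" "q \<sqsubseteq>\<^bsub>P\<^esub> G (F t)" for t q
    proof -
      have tc: "t \<in> carrier P" using Suc t by blast
      obtain y where y: "y \<in> carrier Q" "q = G y" using G_down[OF Fc[OF tc] q] by blast
      then have "y \<sqsubseteq>\<^bsub>Q\<^esub> F t" using G_emb q Fc tc by blast
      then obtain x where x: "x \<in> carrier P" "y = F x" using F_down[OF tc y(1)] by blast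
      then have "x \<sqsubseteq>\<^bsub>P\<^esub> t" using \<open>y \<sqsubseteq>\<^bsub>Q\<^esub> F t\<close> F_emb tc by blast
      then show ?thesis using Suc t x y by blast
    qed
    moreover have "G ` F ` ?T \<subseteq> carrier P" using Suc Fc Gc by blast
    ultimately show ?case unfolding eq by blast
  qed
  have Uc: "U \<subseteq> carrier P" using step by (auto simp: U_def)
  have U_down: "q \<in> U" if "p \<in> U" "q \<in> carrier P" "q \<sqsubseteq>\<^bsub>P\<^esub> p" for p q
  proof -
    obtain n where "p \<in> ((G \<circ> F) ^^ n) ` U0" using \<open>p \<in> U\<close> by (auto simp: U_def)
    then have "q \<in> ((G \<circ> F) ^^ n) ` U0" using step[of n] that(2,3) by blast
    then show ?thesis by (auto simp: U_def)
  qed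
  have U0_U: "U0 \<subseteq> U" unfolding U_def using UN_upper[of 0 UNIV "\<lambda>n. ((G \<circ> F) ^^ n) ` U0"] by simp
  have GF_U: "G (F p) \<in> U" if p: "p \<in> U" for p
  proof -
    obtain n u where "u \<in> U0" "p = ((G \<circ> F) ^^ n) u" using p by (auto simp: U_def)
    then have "G (F p) = ((G \<circ> F) ^^ Suc n) u" "u \<in> U0" by auto
    then show ?thesis unfolding U_def by blast
  qed
  have U_cases: "p \<in> U0 \<or> (\<exists>u \<in> U. p = G (F u))" if p: "p \<in> U" for p
  proof -
    obtain n u where n: "u \<in> U0" "p = ((G \<circ> F) ^^ n) u" using p by (auto simp: U_def)
    show ?thesis
    proof (cases n)
      case (Suc m)
      then have "p = G (F (((G \<circ> F) ^^ m) u))" using n by simp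
      moreover have "((G \<circ> F) ^^ m) u \<in> U" using n(1) by (auto simp: U_def)
      ultimately show ?thesis by blast
    qed (use n in auto)
  qed
  have V: "p \<in> carrier P" "p \<notin> U" if "p \<in> V" for p
    using that P.polar_disjoint polar_in_carrier by (fastforce simp: V_def)+
  \<comment> \<open>Comparability in either direction would put a single element into both
    \<open>U\<close> and its polar or into both \<open>U\<close> and \<open>V\<close>.\<close>
  have UV: "\<not> u \<sqsubseteq>\<^bsub>P\<^esub> v" "\<not> v \<sqsubseteq>\<^bsub>P\<^esub> u" if u: "u \<in> U" and v: "v \<in> V" for u v
  proof -
    show "\<not> u \<sqsubseteq>\<^bsub>P\<^esub> v"
      using u v P.polar_down[of v U u] P.polar_disjoint Uc by (auto simp: V_def)
    show "\<not> v \<sqsubseteq>\<^bsub>P\<^esub> u" using u v V U_down by blast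
  qed
  have \<psi>U: "\<psi> p = F p" if "p \<in> U" for p using that by (simp add: \<psi>_def)
  have \<psi>V: "\<psi> p \<in> carrier Q" "G (\<psi> p) = p" if "p \<in> V" for p
    using that V(2) by (auto simp: \<psi>_def V_def inv_into_into f_inv_into_f)
  have \<psi>_V_eq: "\<psi> (G q) = q" if q: "q \<in> carrier Q" "G q \<in> V" for q
    using \<psi>V[OF q(2)] q(1) G_emb Q.le_antisym Q.le_refl by metis
  have \<psi>c: "\<psi> p \<in> carrier Q" if "p \<in> U \<union> V" for p
    using that \<psi>U \<psi>V Fc Uc by auto
  let ?E = "P\<lparr>carrier := U \<union> V\<rparr>"
  have sub: "U \<union> V \<subseteq> carrier P" using Uc V by blast
  have E: "partial_order ?E" using P sub by (rule partial_order_suborder)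
  have "order_isomorphic (regular_open P) (regular_open ?E)"
  proof (rule order_isomorphic_regular_open_dense[OF E P, where e = id])
    fix p assume p: "p \<in> carrier P"
    show "\<exists>q \<in> carrier ?E. id q \<sqsubseteq>\<^bsub>P\<^esub> p"
    \<comment> \<open>An element of the polar of \<open>U\<close> is outside \<open>U0\<close>,
      hence compatible with the range of \<open>G\<close>, and a common lower bound lies in
      \<open>V\<close>. Any other element has a member of \<open>U\<close> below it.\<close>
    proof (cases "p \<in> polar P U")
      case True
      then have "p \<notin> U0" using U0_U P.polar_disjoint by blast
      then obtain q r where r: "q \<in> carrier Q" "r \<in> carrier P" "r \<sqsubseteq>\<^bsub>P\<^esub> p" "r \<sqsubseteq>\<^bsub>P\<^esub> G q"
        using p by (auto simp: U0_def polar_def)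
      then have "r \<in> V" using P.polar_down[OF True r(2,3)] G_down[OF r(1,2,4)] by (simp add: V_def)
      then show ?thesis using r by auto
    next
      case False
      then obtain u r where "u \<in> U" "r \<in> carrier P" "r \<sqsubseteq>\<^bsub>P\<^esub> p" "r \<sqsubseteq>\<^bsub>P\<^esub> u"
        using p by (auto simp: polar_def)
      then show ?thesis using U_down by auto
    qed
  qed (use sub in auto)
  moreover have "order_isomorphic (regular_open Q) (regular_open ?E)"
  proof (rule order_isomorphic_regular_open_dense[OF E Q, where e = \<psi>])
    show "\<psi> \<in> carrier ?E \<rightarrow> carrier Q" using \<psi>c by simp
  next
    fix p p' assume "p \<in> carrier ?E" "p' \<in> carrier ?E"
    then have p: "p \<in> U \<union> V" and p': "p' \<in> U \<union> V" by auto
    \<comment> \<open>Orders of values of \<open>\<psi>\<close> are compared after applying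
      \<open>G\<close>, which sends \<open>\<psi> p\<close> to \<open>G (F p)\<close> in
      \<open>U\<close> if \<open>p\<close> is in \<open>U\<close>, and back to \<open>p\<close> if
      \<open>p\<close> is in \<open>V\<close>. In the mixed cases both sides of the equivalence are
      therefore false by \<open>UV\<close>.\<close>
    have G: "G (\<psi> p) \<sqsubseteq>\<^bsub>P\<^esub> G (\<psi> p') \<longleftrightarrow> \<psi> p \<sqsubseteq>\<^bsub>Q\<^esub> \<psi> p'"
      using G_emb[OF \<psi>c[OF p] \<psi>c[OF p']] .
    have "\<psi> p \<sqsubseteq>\<^bsub>Q\<^esub> \<psi> p' \<longleftrightarrow> p \<sqsubseteq>\<^bsub>P\<^esub> p'"
    proof (cases "p \<in> U"; cases "p' \<in> U")
      assume U: "p \<in> U" "p' \<in> U"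
      then have "p \<in> carrier P" "p' \<in> carrier P" using Uc by auto
      then show ?thesis using F_emb \<psi>U[OF U(1)] \<psi>U[OF U(2)] by simp
    next
      assume U: "p \<in> U" "p' \<notin> U"
      then have "p' \<in> V" using p' by simp
      then show ?thesis
        using G UV(1)[OF U(1)] UV(1)[OF GF_U[OF U(1)]] \<psi>U[OF U(1)] \<psi>V(2)[of p'] by simp
    next
      assume U: "p \<notin> U" "p' \<in> U"
      then have "p \<in> V" using p by simp
      then show ?thesis
        using G UV(2)[OF U(2)] UV(2)[OF GF_U[OF U(2)]] \<psi>U[OF U(2)] \<psi>V(2)[of p] by simp
    next
      assume "p \<notin> U" "p' \<notin> U"
      then have "p \<in> V" "p' \<in> V" using p p' by auto
      then show ?thesis using G \<psi>V(2) by simp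
    qed
    then show "\<psi> p \<sqsubseteq>\<^bsub>Q\<^esub> \<psi> p' \<longleftrightarrow> p \<sqsubseteq>\<^bsub>?E\<^esub> p'" by simp
  next
    fix q assume q: "q \<in> carrier Q"
    show "\<exists>p \<in> carrier ?E. \<psi> p \<sqsubseteq>\<^bsub>Q\<^esub> q"
    proof (cases "G q \<in> polar P U")
      case True
      then have "G q \<in> V" using q by (auto simp: V_def)
      then show ?thesis using q \<psi>_V_eq Q.le_refl by (intro bexI[of _ "G q"]) auto
    next
      case False
      then obtain u r where r: "u \<in> U" "r \<in> carrier P" "r \<sqsubseteq>\<^bsub>P\<^esub> G q" "r \<sqsubseteq>\<^bsub>P\<^esub> u"
        using q Gc by (auto simp: polar_def)
      then have "r \<in> U" using U_down by blast
      \<comment> \<open>\<open>r\<close> lies below \<open>G q\<close>, so it is compatible with the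
        range of \<open>G\<close>. Hence it belongs to a later layer and has the form
        \<open>G (F x)\<close>, and cancelling \<open>G\<close> places \<open>F x\<close> below
        \<open>q\<close>.\<close>
      moreover have "r \<notin> U0" using r q P.le_refl by (auto simp: U0_def polar_def)
      ultimately obtain x where x: "x \<in> U" "r = G (F x)" using U_cases by blast
      then have "F x \<in> carrier Q" using Fc Uc by blast
      then have "F x \<sqsubseteq>\<^bsub>Q\<^esub> q" using r(3) x(2) G_emb[OF _ q] by simp
      then show ?thesis using x \<psi>U by (intro bexI[of _ x]) auto
    qed
  qed
  ultimately show ?thesis by (rule order_isomorphic_trans[OF _ order_isomorphic_sym])
qed

section \<open>Embeddings and the posets of copies\<close>

lemma map_tuples:
  "\<lbrakk>xs \<in> tuples n A; f \<in> A \<rightarrow> B\<rbrakk> \<Longrightarrow> map f xs \<in> tuples n B"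
  by (auto simp: tuples_def)

lemma embedding_comp:
  assumes f: "embedding L X Y f" and g: "embedding L Y Z g"
  shows "embedding L X Z (g \<circ> f)"
  unfolding embedding_def
proof (intro conjI ballI)
  have f': "f \<in> universe X \<rightarrow> universe Y" "inj_on f (universe X)"
    and g': "g \<in> universe Y \<rightarrow> universe Z" "inj_on g (universe Y)"
    using f g by (auto simp: embedding_def)
  show "g \<circ> f \<in> universe X \<rightarrow> universe Z" using f' g' by auto
  show "inj_on (g \<circ> f) (universe X)"
    using f' g' by (intro comp_inj_on) (auto intro: inj_on_subset)
  fix i xs assume *: "i \<in> symbols L" "xs \<in> tuples (arity L i) (universe X)"
  then have "map f xs \<in> tuples (arity L i) (universe Y)" using f' map_tuples by blast
  then show "xs \<in> interp X i \<longleftrightarrow> map (g \<circ> f) xs \<in> interp Z i"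
    using f g * by (simp add: embedding_def)
qed

text \<open>Following the factor by \<open>g\<close> gives back \<open>h\<close>, so a relation on a
  tuple over \<open>X\<close> and on its image in \<open>Y\<close> can both be tested in
  \<open>Z\<close>. This pulls copies back along embeddings that need not be surjective.\<close>

lemma embedding_factor:
  assumes g: "embedding L Y Z g" and h: "embedding L X Z h"
    and sub: "h ` universe X \<subseteq> g ` universe Y"
  shows "embedding L X Y (inv_into (universe Y) g \<circ> h)"
  unfolding embedding_def
proof (intro conjI ballI)
  let ?k = "inv_into (universe Y) g \<circ> h"
  have gk: "g (?k x) = h x" if "x \<in> universe X" for x
    using f_inv_into_f[of "h x" g "universe Y"] that sub by auto
  show k: "?k \<in> universe X \<rightarrow> universe Y"
    using sub inv_into_into[of _ g "universe Y"] by auto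
  show "inj_on ?k (universe X)"
    using gk h unfolding embedding_def inj_on_def by metis
  fix i xs assume *: "i \<in> symbols L" "xs \<in> tuples (arity L i) (universe X)"
  then have "map ?k xs \<in> tuples (arity L i) (universe Y)" using k map_tuples by blast
  moreover have "map g (map ?k xs) = map h xs"
    using * gk by (auto simp: tuples_def)
  ultimately show "xs \<in> interp X i \<longleftrightarrow> map ?k xs \<in> interp Y i"
    using g h * unfolding embedding_def by metis
qed

lemma image_inv_into_comp:
  "h ` A \<subseteq> g ` B \<Longrightarrow> g ` (inv_into B g \<circ> h) ` A = h ` A"
  unfolding image_comp[symmetric] by (rule image_inv_into_cancel[OF refl])

lemma embedding_image_subset_iff:
  assumes "embedding L X Y f" "A \<subseteq> universe X" "B \<subseteq> universe X"
  shows "f ` A \<subseteq> f ` B \<longleftrightarrow> A \<subseteq> B"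
proof -
  have "inj_on f (universe X)" using assms(1) by (simp add: embedding_def)
  then have "f x \<in> f ` B \<longleftrightarrow> x \<in> B" if "x \<in> A" for x
    using inj_on_image_mem_iff[of f "universe X" x B] assms(2,3) that by (simp add: subset_iff)
  then show ?thesis by (simp add: image_subset_iff subset_eq)
qed

lemma embedding_image_subset: "embedding L X Y f \<Longrightarrow> f ` universe X \<subseteq> universe Y"
  by (auto simp: embedding_def)

text \<open>Copies correspond by conjugation with \<open>f\<close>: an embedding \<open>h\<close> of
  \<open>X\<close> goes to \<open>f \<circ> h \<circ> ?g\<close>, and an embedding \<open>h\<close>
  of \<open>Y\<close> comes from \<open>?g \<circ> (h \<circ> f)\<close>, where \<open>?g\<close>
  inverts \<open>f\<close>.\<close>

lemma order_isomorphic_copies: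
  assumes f: "embedding L X Y f" and surj: "f ` universe X = universe Y"
  shows "order_isomorphic (copies L X) (copies L Y)"
proof (rule order_isomorphicI)
  let ?g = "inv_into (universe X) f"
  \<comment> \<open>As \<open>f\<close> is onto, the identity of \<open>Y\<close> factors through
    it, and the factor is the inverse of \<open>f\<close>.\<close>
  have id: "embedding L Y Y id" by (auto simp: embedding_def)
  have g: "embedding L Y X ?g" using embedding_factor[OF f id] surj by simp
  have gY: "?g ` universe Y = universe X"
    using f surj by (metis embedding_def inv_into_image_cancel subset_refl)
  show "partial_order (copies L X)" "weak_partial_order (copies L Y)"
    using partial_order_copies partial_order.axioms(1) by blast+
  show "(`) f ` carrier (copies L X) = carrier (copies L Y)"
  proof
    show "(`) f ` carrier (copies L X) \<subseteq> carrier (copies L Y)"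
    proof
      fix B assume "B \<in> (`) f ` carrier (copies L X)"
      then obtain h where h: "embedding L X X h" "B = f ` h ` universe X"
        by (auto simp: copies_def)
      have "embedding L Y Y (f \<circ> h \<circ> ?g)"
        using embedding_comp[OF g embedding_comp[OF h(1) f]] .
      moreover have "B = (f \<circ> h \<circ> ?g) ` universe Y"
        using h(2) gY by (metis image_comp)
      ultimately show "B \<in> carrier (copies L Y)" unfolding copies_def partial_object.simps by blast
    qed
    show "carrier (copies L Y) \<subseteq> (`) f ` carrier (copies L X)"
    proof
      fix B assume "B \<in> carrier (copies L Y)"
      then obtain h where h: "embedding L Y Y h" "B = h ` universe Y"
        by (auto simp: copies_def)
      have hf: "embedding L X Y (h \<circ> f)" using embedding_comp[OF f h(1)] .
      have sub: "(h \<circ> f) ` universe X \<subseteq> f ` universe X"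
        using embedding_image_subset[OF hf] surj by simp
      have "embedding L X X (?g \<circ> (h \<circ> f))" using embedding_factor[OF f hf sub] .
      moreover have "B = f ` (?g \<circ> (h \<circ> f)) ` universe X"
        using image_inv_into_comp[OF sub] h(2) surj by (metis image_comp)
      ultimately show "B \<in> (`) f ` carrier (copies L X)"
        unfolding copies_def partial_object.simps by blast
    qed
  qed
  fix A B assume "A \<in> carrier (copies L X)" "B \<in> carrier (copies L X)"
  then have "A \<subseteq> universe X" "B \<subseteq> universe X"
    by (auto simp: copies_def dest: embedding_image_subset)
  then show "f ` A \<sqsubseteq>\<^bsub>copies L Y\<^esub> f ` B \<longleftrightarrow> A \<sqsubseteq>\<^bsub>copies L X\<^esub> B"
    using embedding_image_subset_iff[OF f] by (simp add: copies_def)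
qed

section \<open>Subsets that contain a copy\<close>

text \<open>An embedding of \<open>X\<close> into a non-isomorphic \<open>Y\<close> sends no copy of
  \<open>X\<close> to a copy of \<open>Y\<close>, so the posets of copies cannot be compared by
  taking images directly. Separating the copied structure \<open>X\<close> from the ambient
  \<open>Z\<close> allows one \<open>X\<close> to be kept fixed while the ambient structure
  changes.\<close>

definition supersets_of_copies ::
    "'i language \<Rightarrow> ('i, 'a) rel_structure \<Rightarrow> ('i, 'b) rel_structure \<Rightarrow> 'b set gorder" where
  "supersets_of_copies L X Z =
     \<lparr>carrier = {A. A \<subseteq> universe Z \<and> (\<exists>h. embedding L X Z h \<and> h ` universe X \<subseteq> A)},
      eq = (=), le = (\<subseteq>)\<rparr>"

lemma partial_order_supersets_of_copies: "partial_order (supersets_of_copies L X Z)"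
  by unfold_locales (auto simp: supersets_of_copies_def)

lemma le_supersets_of_copies [simp]: "A \<sqsubseteq>\<^bsub>supersets_of_copies L X Z\<^esub> B \<longleftrightarrow> A \<subseteq> B"
  by (simp add: supersets_of_copies_def)

text \<open>Inside the copy \<open>h[X]\<close> lies the copy \<open>h[g[Y]]\<close> of
  \<open>Y\<close>.\<close>

lemma supersets_of_copies_mono:
  assumes "embedding L Y X g"
  shows "carrier (supersets_of_copies L X Z) \<subseteq> carrier (supersets_of_copies L Y Z)"
proof
  fix A assume "A \<in> carrier (supersets_of_copies L X Z)"
  then obtain h where h: "A \<subseteq> universe Z" "embedding L X Z h" "h ` universe X \<subseteq> A"
    by (auto simp: supersets_of_copies_def)
  moreover have "embedding L Y Z (h \<circ> g)" using embedding_comp[OF assms h(2)] .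
  moreover have "(h \<circ> g) ` universe Y \<subseteq> A" using embedding_image_subset[OF assms] h(3) by auto
  ultimately show "A \<in> carrier (supersets_of_copies L Y Z)"
    by (auto simp: supersets_of_copies_def intro!: exI[of _ "h \<circ> g"])
qed

lemma supersets_of_copies_cong:
  assumes "equimorphic L X Y"
  shows "supersets_of_copies L X Z = supersets_of_copies L Y Z"
proof -
  have "carrier (supersets_of_copies L X Z) = carrier (supersets_of_copies L Y Z)"
    using assms by (auto simp: equimorphic_def dest: supersets_of_copies_mono)
  then show ?thesis by (simp add: supersets_of_copies_def)
qed

lemma order_isomorphic_ro_sq_copies:
  "order_isomorphic (ro (sq (copies L X))) (regular_open (supersets_of_copies L X X))"
proof -
  have "order_isomorphic (regular_open (supersets_of_copies L X X)) (regular_open (copies L X))"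
    by (rule order_isomorphic_regular_open_dense[OF partial_order_copies
          partial_order_supersets_of_copies, where e = id])
      (auto simp: copies_def supersets_of_copies_def
        intro: embedding_image_subset[THEN subsetD, OF _ imageI])
  then show ?thesis
    using order_isomorphic_ro_sq[OF partial_order_copies]
      order_isomorphic_trans order_isomorphic_sym by blast
qed

lemma image_supersets_of_copies:
  assumes f: "embedding L Y Z f" and A: "A \<in> carrier (supersets_of_copies L X Y)"
  shows "f ` A \<in> carrier (supersets_of_copies L X Z)"
proof -
  obtain h where h: "A \<subseteq> universe Y" "embedding L X Y h" "h ` universe X \<subseteq> A"
    using A by (auto simp: supersets_of_copies_def)
  have "embedding L X Z (f \<circ> h)" using embedding_comp[OF h(2) f] .
  moreover have "(f \<circ> h) ` universe X \<subseteq> f ` A" using h(3) by auto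
  moreover have "f ` A \<subseteq> universe Z" using embedding_image_subset[OF f] h(1) by auto
  ultimately show ?thesis
    by (auto simp: supersets_of_copies_def intro!: exI[of _ "f \<circ> h"])
qed

text \<open>This is the downward closure of the range required by the Cantor-Bernstein theorem. A
  copy \<open>h[X]\<close> inside \<open>B\<close> lies in the range of \<open>f\<close>, so
  \<open>h\<close> factors through \<open>f\<close>, and the factor places a copy of
  \<open>X\<close> inside the preimage \<open>A'\<close> of \<open>B\<close>.\<close>

lemma image_supersets_of_copies_down:
  assumes f: "embedding L Y Z f" and A: "A \<subseteq> universe Y"
    and B: "B \<in> carrier (supersets_of_copies L X Z)" "B \<subseteq> f ` A"
  shows "B \<in> (`) f ` carrier (supersets_of_copies L X Y)"
proof -
  obtain h where h: "embedding L X Z h" "h ` universe X \<subseteq> B"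
    using B(1) by (auto simp: supersets_of_copies_def)
  let ?k = "inv_into (universe Y) f \<circ> h"
  obtain A' where A': "A' \<subseteq> A" "B = f ` A'" using B(2) by (auto simp: subset_image_iff)
  have sub: "h ` universe X \<subseteq> f ` universe Y" using h(2) A' A by blast
  have k: "embedding L X Y ?k" using embedding_factor[OF f h(1) sub] .
  have "f ` ?k ` universe X \<subseteq> f ` A'" using image_inv_into_comp[OF sub] h(2) A' by simp
  then have "?k ` universe X \<subseteq> A'"
    using embedding_image_subset_iff[OF f embedding_image_subset[OF k]] A' A by blast
  then have "A' \<in> carrier (supersets_of_copies L X Y)"
    using k A' A by (auto simp: supersets_of_copies_def intro!: exI[of _ ?k])
  then show ?thesis using A' by blast
qed

lemma order_isomorphic_regular_open_supersets:
  assumes f: "embedding L Y Z f" and g: "embedding L Z Y g"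
  shows "order_isomorphic (regular_open (supersets_of_copies L X Y))
    (regular_open (supersets_of_copies L X Z))"
proof -
  have subY: "A \<subseteq> universe Y" if "A \<in> carrier (supersets_of_copies L X Y)" for A
    using that by (simp add: supersets_of_copies_def)
  have subZ: "A \<subseteq> universe Z" if "A \<in> carrier (supersets_of_copies L X Z)" for A
    using that by (simp add: supersets_of_copies_def)
  show ?thesis
    by (rule order_isomorphic_regular_open_Cantor_Bernstein[OF partial_order_supersets_of_copies
          partial_order_supersets_of_copies, where F = "(`) f" and G = "(`) g"])
      (use image_supersets_of_copies[OF f, of _ X] image_supersets_of_copies[OF g, of _ X] subY subZ
        image_supersets_of_copies_down[OF f subY, of _ _ X]
        image_supersets_of_copies_down[OF g subZ, of _ _ X]
        embedding_image_subset_iff[OF f] embedding_image_subset_iff[OF g] in \<open>simp_all add: Pi_iff\<close>)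
qed

theorem theorem2p10:
  fixes L :: "'i language"
    and X :: "('i, 'a) rel_structure"
    and Y :: "('i, 'b) rel_structure"
  assumes "relational_language L"
    and "is_structure L X"
    and "is_structure L Y"
  shows "(isomorphic_structures L X Y \<longrightarrow> order_isomorphic (copies L X) (copies L Y)) \<and>
         (equimorphic L X Y \<longrightarrow>
            order_isomorphic (ro (sq (copies L X))) (ro (sq (copies L Y))))"
proof (intro conjI impI)
  assume "isomorphic_structures L X Y"
  then show "order_isomorphic (copies L X) (copies L Y)"
    unfolding isomorphic_structures_def using order_isomorphic_copies by blast
next
  assume eqm: "equimorphic L X Y"
  \<comment> \<open>The ambient structure is changed from \<open>X\<close> to \<open>Y\<close> with
    copies of \<open>X\<close> on both sides; over \<open>Y\<close>, equimorphism then allows copies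
    of \<open>X\<close> to be replaced by copies of \<open>Y\<close>.\<close>
  then have "order_isomorphic (regular_open (supersets_of_copies L X X))
      (regular_open (supersets_of_copies L Y Y))"
    using order_isomorphic_regular_open_supersets[of L X Y _ _ X] supersets_of_copies_cong[OF eqm]
    unfolding equimorphic_def by metis
  then show "order_isomorphic (ro (sq (copies L X))) (ro (sq (copies L Y)))"
    by (meson order_isomorphic_ro_sq_copies order_isomorphic_sym order_isomorphic_trans)
qed

end
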